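(* Let $\sigma$ be any subsequence (possibly empty) of $e\,w_l\,w_r\,c$. Neither $\mathbb{PM}^{sl}_\sigma$ nor $\mathbb{PM}^{\ell}_\sigma$ is the equivalent algebraic semantics of any Hilbert system (in the respective language $\langle\vee,*,\neg_r,\neg_l,0,1\rangle$, resp. $\langle\vee,\wedge,*,\neg_r,\neg_l,0,1\rangle$).
   Context: For a subsequence $\sigma$ of $e\,w_l\,w_r\,c$ ($a\le b$ means $a\vee b=b$): $\mathring{\mathbb{M}}^{sl}_\sigma$ is the class of algebras $\langle A,\vee,*,0,1\rangle$ with $\langle A,\vee\rangle$ a join-semilattice, $\langle A,*,1\rangle$ a monoid, $*$ distributing over $\vee$ on both sides, $0$ an arbitrary element, and satisfying, for each letter in $\sigma$: $e$: $x*y=y*x$; $w_l$: $x\le 1$; $w_r$: $0\le x$; $c$: $x\le x*x$. $\mathring{\mathbb{M}}^{\ell}_\sigma$ is the class of algebras $\langle A,\vee,\wedge,*,0,1\rangle$ whose $\langle\vee,\wedge\rangle$-reduct is a lattice and whose $\langle\vee,*,0,1\rangle$-reduct lies in $\mathring{\mathbb{M}}^{sl}_\sigma$. $\mathbb{PM}^{sl}_\sigma$ (resp. $\mathbb{PM}^{\ell}_\sigma$) is the class of algebras $\langle A,\vee,*,\neg_r,\neg_l,0,1\rangle$ (resp. $\langle A,\vee,\wedge,*,\neg_r,\neg_l,0,1\rangle$) with unary $\neg_r,\neg_l$ whose reduct without $\neg_r,\neg_l$ lies in $\mathring{\mathbb{M}}^{sl}_\sigma$ (resp. $\mathring{\mathbb{M}}^{\ell}_\sigma$)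 and such that for all $a,b$: $a*b\le 0$ iff $b\le\neg_r a$ iff $a\le\neg_l b$. A Hilbert system on a propositional language $\Psi$ is a substitution-invariant consequence relation $\vdash$ on $\Psi$-formulas. A class $\mathbb{K}$ of $\Psi$-algebras is the equivalent algebraic semantics of $\vdash$ (in the sense of Blok–Pigozzi) if there are translations $\tau$ from formulas to finite sets of $\Psi$-equations and $\rho$ from equations to finite sets of formulas, each given by a schema in variables, such that $\Gamma\vdash\varphi$ iff $\tau[\Gamma]\models_{\mathbb{K}}\tau(\varphi)$, and each equation $\varphi\approx\psi$ is $\models_{\mathbb{K}}$-interderivable with $\tau(\rho(\varphi\approx\psi))$; $E\models_{\mathbb{K}}\varepsilon$ means every assignment into a member of $\mathbb{K}$ satisfying $E$ satisfies $\varepsilon$. *)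

theory Defs
  imports "HOL-Algebra.Group" "HOL-Library.Sublist"
begin

section \<open>Propositional languages, formulas and algebras\<close>

text \<open>
  A language is given by three types, of its nullary, unary and binary connectives.
  Formulas are built over denumerably many variables.
\<close>

datatype ('c, 'u, 'b) form =
  Var nat
| Const 'c
| Unary 'u "('c, 'u, 'b) form"
| Binary 'b "('c, 'u, 'b) form" "('c, 'u, 'b) form"

primrec vars :: "('c, 'u, 'b) form \<Rightarrow> nat set" where
  "vars (Var i) = {i}"
| "vars (Const k) = {}"
| "vars (Unary u \<phi>) = vars \<phi>"
| "vars (Binary b \<phi> \<psi>) = vars \<phi> \<union> vars \<psi>"

primrec subst :: "(nat \<Rightarrow> ('c, 'u, 'b) form) \<Rightarrow> ('c, 'u, 'b) form \<Rightarrow> ('c, 'u, 'b) form" where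
  "subst s (Var i) = s i"
| "subst s (Const k) = Const k"
| "subst s (Unary u \<phi>) = Unary u (subst s \<phi>)"
| "subst s (Binary b \<phi> \<psi>) = Binary b (subst s \<phi>) (subst s \<psi>)"

text \<open>The equation \<open>\<phi> \<approx> \<psi>\<close> is the pair \<open>(\<phi>, \<psi>)\<close>.\<close>

type_synonym ('c, 'u, 'b) eqn = "('c, 'u, 'b) form \<times> ('c, 'u, 'b) form"

record ('a, 'c, 'u, 'b) alg = "'a partial_object" +
  cop :: "'c \<Rightarrow> 'a"
  uop :: "'u \<Rightarrow> 'a \<Rightarrow> 'a"
  bop :: "'b \<Rightarrow> 'a \<Rightarrow> 'a \<Rightarrow> 'a"

primrec interp :: "('a, 'c, 'u, 'b) alg \<Rightarrow> (nat \<Rightarrow> 'a) \<Rightarrow> ('c, 'u, 'b) form \<Rightarrow> 'a" where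
  "interp A v (Var i) = v i"
| "interp A v (Const k) = cop A k"
| "interp A v (Unary u \<phi>) = uop A u (interp A v \<phi>)"
| "interp A v (Binary b \<phi> \<psi>) = bop A b (interp A v \<phi>) (interp A v \<psi>)"

definition satisfies :: "('a, 'c, 'u, 'b) alg \<Rightarrow> (nat \<Rightarrow> 'a) \<Rightarrow> ('c, 'u, 'b) eqn \<Rightarrow> bool" where
  "satisfies A v \<epsilon> \<longleftrightarrow> interp A v (fst \<epsilon>) = interp A v (snd \<epsilon>)"

definition entails ::
  "('a, 'c, 'u, 'b) alg set \<Rightarrow> ('c, 'u, 'b) eqn set \<Rightarrow> ('c, 'u, 'b) eqn \<Rightarrow> bool" where
  "entails K E \<epsilon> \<longleftrightarrow>
    (\<forall>A\<in>K. \<forall>v. range v \<subseteq> carrier A \<longrightarrow> (\<forall>\<eta>\<in>E. satisfies A v \<eta>) \<longrightarrow> satisfies A v \<epsilon>)"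


section \<open>Hilbert systems and equivalent algebraic semantics\<close>

text \<open>Finitarity is not required of a Hilbert system.\<close>

definition hilbert_system ::
  "(('c, 'u, 'b) form set \<Rightarrow> ('c, 'u, 'b) form \<Rightarrow> bool) \<Rightarrow> bool" where
  "hilbert_system H \<longleftrightarrow>
    (\<forall>\<Gamma> \<phi>. \<phi> \<in> \<Gamma> \<longrightarrow> H \<Gamma> \<phi>) \<and>
    (\<forall>\<Gamma> \<Delta> \<phi>. H \<Gamma> \<phi> \<longrightarrow> \<Gamma> \<subseteq> \<Delta> \<longrightarrow> H \<Delta> \<phi>) \<and>
    (\<forall>\<Gamma> \<Delta> \<phi>. (\<forall>\<psi>\<in>\<Delta>. H \<Gamma> \<psi>) \<longrightarrow> H \<Delta> \<phi> \<longrightarrow> H \<Gamma> \<phi>) \<and>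
    (\<forall>\<Gamma> \<phi> s. H \<Gamma> \<phi> \<longrightarrow> H (subst s ` \<Gamma>) (subst s \<phi>))"

text \<open>
  The translation \<open>\<tau>\<close> is given by a finite set \<open>T\<close> of equations in the variable \<open>Var 0\<close>, and
  \<open>\<rho>\<close> by a finite set \<open>D\<close> of formulas in the variables \<open>Var 0\<close> and \<open>Var 1\<close>.
\<close>

definition form_to_eqns ::
  "('c, 'u, 'b) eqn set \<Rightarrow> ('c, 'u, 'b) form \<Rightarrow> ('c, 'u, 'b) eqn set" where
  "form_to_eqns T \<phi> = (\<lambda>(\<delta>, \<epsilon>). (subst (\<lambda>_. \<phi>) \<delta>, subst (\<lambda>_. \<phi>) \<epsilon>)) ` T"

definition eqn_to_forms ::
  "('c, 'u, 'b) form set \<Rightarrow> ('c, 'u, 'b) eqn \<Rightarrow> ('c, 'u, 'b) form set" where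
  "eqn_to_forms D \<epsilon> = subst (\<lambda>i. if i = 0 then fst \<epsilon> else snd \<epsilon>) ` D"

definition equivalent_algebraic_semantics ::
  "('a, 'c, 'u, 'b) alg set \<Rightarrow> (('c, 'u, 'b) form set \<Rightarrow> ('c, 'u, 'b) form \<Rightarrow> bool) \<Rightarrow> bool" where
  "equivalent_algebraic_semantics K H \<longleftrightarrow>
    (\<exists>T D. finite T \<and> (\<forall>(\<delta>, \<epsilon>)\<in>T. vars \<delta> \<subseteq> {0} \<and> vars \<epsilon> \<subseteq> {0}) \<and>
           finite D \<and> (\<forall>\<phi>\<in>D. vars \<phi> \<subseteq> {0, 1}) \<and>
      (\<forall>\<Gamma> \<phi>. H \<Gamma> \<phi> \<longleftrightarrow>
         (\<forall>\<eta>\<in>form_to_eqns T \<phi>. entails K (\<Union>\<gamma>\<in>\<Gamma>. form_to_eqns T \<gamma>) \<eta>)) \<and>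
      (\<forall>\<epsilon>. (\<forall>\<eta>\<in>(\<Union>\<psi>\<in>eqn_to_forms D \<epsilon>. form_to_eqns T \<psi>). entails K {\<epsilon>} \<eta>) \<and>
            entails K (\<Union>\<psi>\<in>eqn_to_forms D \<epsilon>. form_to_eqns T \<psi>) \<epsilon>))"


section \<open>Semilattice- and lattice-ordered monoids with pseudocomplements\<close>

datatype letter = Exch | WeakL | WeakR | Contr

text \<open>The sequence \<open>e w\<^sub>l w\<^sub>r c\<close>.\<close>

abbreviation letters :: "letter list" where
  "letters \<equiv> [Exch, WeakL, WeakR, Contr]"

definition semilattice_on :: "'a set \<Rightarrow> ('a \<Rightarrow> 'a \<Rightarrow> 'a) \<Rightarrow> bool" where
  "semilattice_on A f \<longleftrightarrow>
    (\<forall>x\<in>A. \<forall>y\<in>A. f x y \<in> A) \<and>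
    (\<forall>x\<in>A. \<forall>y\<in>A. \<forall>z\<in>A. f (f x y) z = f x (f y z)) \<and>
    (\<forall>x\<in>A. \<forall>y\<in>A. f x y = f y x) \<and>
    (\<forall>x\<in>A. f x x = x)"

definition lattice_on :: "'a set \<Rightarrow> ('a \<Rightarrow> 'a \<Rightarrow> 'a) \<Rightarrow> ('a \<Rightarrow> 'a \<Rightarrow> 'a) \<Rightarrow> bool" where
  "lattice_on A jn mt \<longleftrightarrow>
    semilattice_on A jn \<and> semilattice_on A mt \<and>
    (\<forall>x\<in>A. \<forall>y\<in>A. jn x (mt x y) = x \<and> mt x (jn x y) = x)"

definition join_le :: "('a \<Rightarrow> 'a \<Rightarrow> 'a) \<Rightarrow> 'a \<Rightarrow> 'a \<Rightarrow> bool" where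
  "join_le jn a b \<longleftrightarrow> jn a b = b"

text \<open>
  The arguments of \<open>M_sl \<sigma>\<close> and \<open>M_l \<sigma>\<close> are the carrier and the operations
  \<open>\<or>, *, 0, 1\<close>, respectively \<open>\<or>, \<and>, *, 0, 1\<close>. Operations are unconstrained outside the carrier.
\<close>

definition M_sl ::
  "letter list \<Rightarrow> 'a set \<Rightarrow> ('a \<Rightarrow> 'a \<Rightarrow> 'a) \<Rightarrow> ('a \<Rightarrow> 'a \<Rightarrow> 'a) \<Rightarrow> 'a \<Rightarrow> 'a \<Rightarrow> bool" where
  "M_sl \<sigma> A jn ml z e \<longleftrightarrow>
    semilattice_on A jn \<and>
    monoid \<lparr>carrier = A, monoid.mult = ml, one = e\<rparr> \<and>
    z \<in> A \<and>
    (\<forall>x\<in>A. \<forall>y\<in>A. \<forall>w\<in>A.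
       ml x (jn y w) = jn (ml x y) (ml x w) \<and> ml (jn y w) x = jn (ml y x) (ml w x)) \<and>
    (Exch \<in> set \<sigma> \<longrightarrow> (\<forall>x\<in>A. \<forall>y\<in>A. ml x y = ml y x)) \<and>
    (WeakL \<in> set \<sigma> \<longrightarrow> (\<forall>x\<in>A. join_le jn x e)) \<and>
    (WeakR \<in> set \<sigma> \<longrightarrow> (\<forall>x\<in>A. join_le jn z x)) \<and>
    (Contr \<in> set \<sigma> \<longrightarrow> (\<forall>x\<in>A. join_le jn x (ml x x)))"

definition M_l ::
  "letter list \<Rightarrow> 'a set \<Rightarrow> ('a \<Rightarrow> 'a \<Rightarrow> 'a) \<Rightarrow> ('a \<Rightarrow> 'a \<Rightarrow> 'a) \<Rightarrow> ('a \<Rightarrow> 'a \<Rightarrow> 'a) \<Rightarrow> 'a \<Rightarrow> 'a \<Rightarrow> bool"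
where
  "M_l \<sigma> A jn mt ml z e \<longleftrightarrow> lattice_on A jn mt \<and> M_sl \<sigma> A jn ml z e"

definition pseudocomplements ::
  "'a set \<Rightarrow> ('a \<Rightarrow> 'a \<Rightarrow> 'a) \<Rightarrow> ('a \<Rightarrow> 'a \<Rightarrow> 'a) \<Rightarrow> 'a \<Rightarrow> ('a \<Rightarrow> 'a) \<Rightarrow> ('a \<Rightarrow> 'a) \<Rightarrow> bool"
where
  "pseudocomplements A jn ml z nr nl \<longleftrightarrow>
    (\<forall>a\<in>A. nr a \<in> A \<and> nl a \<in> A) \<and>
    (\<forall>a\<in>A. \<forall>b\<in>A. (join_le jn (ml a b) z \<longleftrightarrow> join_le jn b (nr a)) \<and>
                   (join_le jn b (nr a) \<longleftrightarrow> join_le jn a (nl b)))"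

datatype const_sym = Zero | One
datatype neg_sym = NegR | NegL
datatype sl_sym = SJoin | SMult
datatype l_sym = LJoin | LMeet | LMult

text \<open>
  The members of these classes are the algebras whose carrier is a subset of the type \<open>'a\<close>.
  If \<open>'a\<close> is infinite, the relation \<open>entails\<close> for either class agrees with consequence over algebras
  of arbitrary size: the classes are closed under subalgebras and isomorphic copies, and a
  subalgebra generated by the values of the countably many variables is countable.
\<close>

definition PM_sl :: "letter list \<Rightarrow> ('a, const_sym, neg_sym, sl_sym) alg set" where
  "PM_sl \<sigma> = {A.
     M_sl \<sigma> (carrier A) (bop A SJoin) (bop A SMult) (cop A Zero) (cop A One) \<and>
     pseudocomplements (carrier A) (bop A SJoin) (bop A SMult) (cop A Zero)
       (uop A NegR) (uop A NegL)}"

definition PM_l :: "letter list \<Rightarrow> ('a, const_sym, neg_sym, l_sym) alg set" where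
  "PM_l \<sigma> = {A.
     M_l \<sigma> (carrier A) (bop A LJoin) (bop A LMeet) (bop A LMult) (cop A Zero) (cop A One) \<and>
     pseudocomplements (carrier A) (bop A LJoin) (bop A LMult) (cop A Zero)
       (uop A NegR) (uop A NegL)}"

end

theory Submission
  imports Defs
begin

text \<open>
  If \<open>\<tau>, \<rho>\<close> witness algebraizability, then \<open>x = y\<close> in a member of the class holds exactly when
  finitely many elements \<open>d(x, y)\<close> satisfy the equations \<open>\<tau>\<close> in one variable. Hence a homomorphism
  between members that is injective on one-generated subalgebras is injective. Now take the chain
  \<open>0 < 1 < 2 < 3\<close> with \<open>*\<close> the meet, \<open>\<not>0 = 3\<close> and \<open>\<not>c = 0\<close> otherwise; it belongs to the class for
  every \<open>\<sigma>\<close>. The endomorphism sending \<open>2\<close> to \<open>1\<close> and fixing the rest is not injective, but it is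
  injective on \<open>{0, c, 3}\<close>, which contains the subalgebra generated by \<open>c\<close>.
\<close>

text \<open>The type \<open>alg\<close> does not force a carrier to be closed under the operations,
  so closure of \<open>A\<close> itself is expressed as
  \<open>subuniverse A (carrier A)\<close>.\<close>

definition subuniverse :: "('a, 'c, 'u, 'b) alg \<Rightarrow> 'a set \<Rightarrow> bool" where
  "subuniverse A S \<longleftrightarrow>
    (\<forall>k. cop A k \<in> S) \<and> (\<forall>u. \<forall>x\<in>S. uop A u x \<in> S) \<and> (\<forall>b. \<forall>x\<in>S. \<forall>y\<in>S. bop A b x y \<in> S)"

definition alg_hom ::
  "('a, 'c, 'u, 'b) alg \<Rightarrow> ('d, 'c, 'u, 'b) alg \<Rightarrow> ('a \<Rightarrow> 'd) \<Rightarrow> bool" where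
  "alg_hom A B h \<longleftrightarrow>
    h ` carrier A \<subseteq> carrier B \<and>
    (\<forall>k. h (cop A k) = cop B k) \<and>
    (\<forall>u. \<forall>x\<in>carrier A. h (uop A u x) = uop B u (h x)) \<and>
    (\<forall>b. \<forall>x\<in>carrier A. \<forall>y\<in>carrier A. h (bop A b x y) = bop B b (h x) (h y))"

lemma interp_subst: "interp A v (subst s \<phi>) = interp A (\<lambda>i. interp A v (s i)) \<phi>"
  by (induction \<phi>) auto

lemma interp_in_subuniverse:
  assumes "subuniverse A S" and "range v \<subseteq> S"
  shows "interp A v \<phi> \<in> S"
  using assms by (induction \<phi>) (auto simp: subuniverse_def)

lemma interp_alg_hom:
  assumes "alg_hom A B h" and "subuniverse A (carrier A)" and "range v \<subseteq> carrier A"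
  shows "h (interp A v \<phi>) = interp B (h \<circ> v) \<phi>"
  using assms interp_in_subuniverse[OF assms(2,3)]
  by (induction \<phi>) (auto simp: alg_hom_def)

text \<open>If \<open>h x = h y\<close>, the image assignment satisfies the translated equations in
  \<open>B\<close>. Each of them speaks about one element \<open>c\<close> of \<open>A\<close> only,
  and \<open>h\<close> reflects equality on a set \<open>S\<close> around \<open>c\<close>. So they
  already hold in \<open>A\<close>, where they force \<open>x = y\<close>.\<close>

lemma equivalent_algebraic_semantics_inj_on:
  fixes A B :: "('a, 'c, 'u, 'b) alg"
  assumes "equivalent_algebraic_semantics K H" and "A \<in> K" and "B \<in> K"
    and hom: "alg_hom A B h" and closed: "subuniverse A (carrier A)"
    and inj: "\<And>c. c \<in> carrier A \<Longrightarrow> \<exists>S. c \<in> S \<and> subuniverse A S \<and> inj_on h S"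
  shows "inj_on h (carrier A)"
proof (rule inj_onI)
  fix x y assume x: "x \<in> carrier A" and y: "y \<in> carrier A" and eq: "h x = h y"
  let ?e = "(Var 0, Var 1) :: ('c, 'u, 'b) eqn"
  obtain T D where "\<forall>\<epsilon>.
      (\<forall>\<eta>\<in>(\<Union>\<psi>\<in>eqn_to_forms D \<epsilon>. form_to_eqns T \<psi>). entails K {\<epsilon>} \<eta>) \<and>
      entails K (\<Union>\<psi>\<in>eqn_to_forms D \<epsilon>. form_to_eqns T \<psi>) \<epsilon>"
    using assms(1) unfolding equivalent_algebraic_semantics_def by (elim exE conjE) (rule that)
  note this[THEN spec, of ?e]
  then have
    fwd: "\<And>\<psi> \<eta>. \<psi> \<in> eqn_to_forms D ?e \<Longrightarrow> \<eta> \<in> form_to_eqns T \<psi> \<Longrightarrow> entails K {?e} \<eta>"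
    and bwd: "entails K (\<Union>\<psi>\<in>eqn_to_forms D ?e. form_to_eqns T \<psi>) ?e"
    by auto
  \<comment> \<open>Variables from 2 on also get \<open>y\<close>, which keeps the whole range in
    the carrier.\<close>
  define v where "v = (\<lambda>i::nat. if i = 0 then x else y)"
  have v: "range v \<subseteq> carrier A" using x y by (auto simp: v_def)
  have hv: "range (h \<circ> v) \<subseteq> carrier B" using v hom by (auto simp: alg_hom_def)
  have "satisfies A v \<eta>"
    if \<psi>: "\<psi> \<in> eqn_to_forms D ?e" and \<eta>: "\<eta> \<in> form_to_eqns T \<psi>" for \<psi> \<eta>
  proof -
    obtain \<delta> \<epsilon> where \<eta>_eq: "\<eta> = (subst (\<lambda>_. \<psi>) \<delta>, subst (\<lambda>_. \<psi>) \<epsilon>)"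
      using \<eta> by (auto simp: form_to_eqns_def)
    define c where "c = interp A v \<psi>"
    have c: "c \<in> carrier A" unfolding c_def by (rule interp_in_subuniverse[OF closed v])
    obtain S where S: "c \<in> S" "subuniverse A S" "inj_on h S" using inj[OF c] by blast
    have "satisfies B (h \<circ> v) ?e" by (simp add: satisfies_def v_def eq)
    then have "satisfies B (h \<circ> v) \<eta>"
      using fwd[OF \<psi> \<eta>] \<open>B \<in> K\<close> hv by (simp add: entails_def)
    moreover have "interp B (h \<circ> v) \<psi> = h c"
      unfolding c_def by (rule interp_alg_hom[OF hom closed v, symmetric])
    \<comment> \<open>Since \<open>\<psi>\<close> replaces every variable, the substituted sides are
      values of \<delta> and \<epsilon> at a constant assignment.\<close>
    ultimately have "interp B (\<lambda>_. h c) \<delta> = interp B (\<lambda>_. h c) \<epsilon>"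
      by (simp only: satisfies_def \<eta>_eq interp_subst fst_conv snd_conv)
    moreover have "h (interp A (\<lambda>_. c) \<chi>) = interp B (\<lambda>_. h c) \<chi>" for \<chi>
      using interp_alg_hom[OF hom closed, of "\<lambda>_. c" \<chi>] c by (simp add: comp_def)
    ultimately have "h (interp A (\<lambda>_. c) \<delta>) = h (interp A (\<lambda>_. c) \<epsilon>)" by (simp only:)
    moreover have "interp A (\<lambda>_. c) \<chi> \<in> S" for \<chi>
      by (rule interp_in_subuniverse[OF S(2)]) (simp add: S(1))
    ultimately have "interp A (\<lambda>_. c) \<delta> = interp A (\<lambda>_. c) \<epsilon>"
      by (simp only: inj_on_eq_iff[OF S(3)])
    then show ?thesis by (simp add: satisfies_def \<eta>_eq interp_subst c_def)
  qed
  then have "satisfies A v ?e" using bwd \<open>A \<in> K\<close> v by (auto simp: entails_def)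
  then show "x = y" by (simp add: satisfies_def v_def)
qed

text \<open>The injection \<open>f\<close> only serves to realize the chain inside an arbitrary infinite type.\<close>

definition four_chain ::
  "(nat \<Rightarrow> 'a) \<Rightarrow> ('b \<Rightarrow> nat \<Rightarrow> nat \<Rightarrow> nat) \<Rightarrow> ('a, const_sym, neg_sym, 'b) alg" where
  "four_chain f op =
    \<lparr>carrier = f ` {..3},
     cop = case_const_sym (f 0) (f 3),
     uop = (\<lambda>_ x. f (if the_inv f x = 0 then 3 else 0)),
     bop = (\<lambda>b x y. f (op b (the_inv f x) (the_inv f y)))\<rparr>"

primrec sl_op :: "sl_sym \<Rightarrow> nat \<Rightarrow> nat \<Rightarrow> nat" where
  "sl_op SJoin = max"
| "sl_op SMult = min"

primrec l_op :: "l_sym \<Rightarrow> nat \<Rightarrow> nat \<Rightarrow> nat" where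
  "l_op LJoin = max"
| "l_op LMeet = min"
| "l_op LMult = min"

context
  fixes f :: "nat \<Rightarrow> 'a"
  assumes inj_f: "inj f"
begin

lemmas [simp] = the_inv_f_f[OF inj_f] inj_eq[OF inj_f]

abbreviation chain_join :: "'a \<Rightarrow> 'a \<Rightarrow> 'a" where
  "chain_join x y \<equiv> f (max (the_inv f x) (the_inv f y))"

abbreviation chain_meet :: "'a \<Rightarrow> 'a \<Rightarrow> 'a" where
  "chain_meet x y \<equiv> f (min (the_inv f x) (the_inv f y))"

abbreviation chain_neg :: "'a \<Rightarrow> 'a" where
  "chain_neg x \<equiv> f (if the_inv f x = 0 then 3 else 0)"

lemma lattice_four_chain: "lattice_on (f ` {..3}) chain_join chain_meet"
  by (simp add: lattice_on_def semilattice_on_def ac_simps)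

text \<open>The product is the meet, \<open>f 3\<close> is the top and \<open>f 0\<close> the
  bottom, so the conditions of all four letters hold at once.\<close>

lemma M_sl_four_chain: "M_sl \<sigma> (f ` {..3}) chain_join chain_meet (f 0) (f 3)"
proof -
  have "monoid \<lparr>carrier = f ` {..3}, monoid.mult = chain_meet, one = f 3\<rparr>"
    by (rule monoidI) (auto simp: min.assoc)
  moreover have "semilattice_on (f ` {..3}) chain_join"
    using lattice_four_chain by (simp add: lattice_on_def)
  ultimately show ?thesis
    by (simp add: M_sl_def join_le_def min_max_distrib1 min_max_distrib2 min.commute)
qed

text \<open>In a chain a meet is the bottom only if one of its arguments is.\<close>

lemma pseudocomplements_four_chain:
  "pseudocomplements (f ` {..3}) chain_join chain_meet (f 0) chain_neg chain_neg"
  by (auto simp: pseudocomplements_def join_le_def)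

lemma four_chain_in_PM_sl: "four_chain f sl_op \<in> PM_sl \<sigma>"
  using M_sl_four_chain pseudocomplements_four_chain by (simp add: PM_sl_def four_chain_def)

lemma four_chain_in_PM_l: "four_chain f l_op \<in> PM_l \<sigma>"
  using M_sl_four_chain lattice_four_chain pseudocomplements_four_chain
  by (simp add: PM_l_def M_l_def four_chain_def)

text \<open>Leaving \<open>op\<close> open to any choice of \<open>min\<close> and
  \<open>max\<close> covers both languages with one argument.\<close>

lemma four_chain_not_algebraizable:
  assumes op: "\<And>b. op b = min \<or> op b = max" and mem: "four_chain f op \<in> K"
  shows "\<not> equivalent_algebraic_semantics K H"
proof
  assume K: "equivalent_algebraic_semantics K H"
  define k where "k = (\<lambda>i::nat. if i = 2 then 1 else i)"
  define h where "h = f \<circ> k \<circ> the_inv f"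
  have h: "h (f i) = f (k i)" for i by (simp add: h_def)
  have op_closed: "op b i j \<in> {i, j}" for b i j
    using op[of b] by (elim disjE) (auto simp: min_def max_def)
  \<comment> \<open>Monotone maps between chains preserve \<open>min\<close> and \<open>max\<close>.
    Negation is preserved because \<open>k\<close> fixes 0 and 3 and sends only 0 to 0.\<close>
  have "mono k" by (auto simp: k_def mono_def)
  then have k_op: "k (op b i j) = op b (k i) (k j)" for b i j
    using op[of b] by (elim disjE) (simp_all add: min_of_mono max_of_mono)
  \<comment> \<open>Constants and negations take only the values \<open>f 0\<close> and
    \<open>f 3\<close>, and each binary operation returns one of its arguments.\<close>
  have sub: "subuniverse (four_chain f op) (f ` I)" if "0 \<in> I" "3 \<in> I" for I
  proof -
    have "op b i j \<in> I" if "i \<in> I" "j \<in> I" for b i j using op_closed[of b i j] that by auto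
    then show ?thesis
      using that by (auto simp: subuniverse_def four_chain_def split: const_sym.split)
  qed
  have "inj_on h (carrier (four_chain f op))"
  proof (rule equivalent_algebraic_semantics_inj_on[OF K mem mem])
    show "alg_hom (four_chain f op) (four_chain f op) h"
      using k_op
      by (auto simp: alg_hom_def four_chain_def h split: const_sym.split)
        (auto simp: k_def split: if_splits)
    show "subuniverse (four_chain f op) (carrier (four_chain f op))"
      using sub[of "{..3}"] by (simp add: four_chain_def)
    fix c assume "c \<in> carrier (four_chain f op)"
    then obtain i where "c = f i" by (auto simp: four_chain_def)
    moreover have "inj_on h (f ` {0, i, 3})"
    proof (rule inj_on_imageI)
      \<comment> \<open>The only distinct numbers that \<open>k\<close> identifies are 1 and 2, and
        this set contains at most one of them.\<close>
      have "inj_on k {0, i, 3}" by (simp add: k_def inj_on_def)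
      moreover have "h \<circ> f = f \<circ> k" using h by (simp add: fun_eq_iff)
      ultimately show "inj_on (h \<circ> f) {0, i, 3}"
        using inj_f by (simp only: comp_inj_on inj_on_subset[OF inj_f subset_UNIV])
    qed
    moreover have "subuniverse (four_chain f op) (f ` {0, i, 3})" by (rule sub) auto
    ultimately show "\<exists>S. c \<in> S \<and> subuniverse (four_chain f op) S \<and> inj_on h S"
      by (intro exI[of _ "f ` {0, i, 3}"]) auto
  qed
  moreover have "h (f 1) = h (f 2)" by (simp add: h k_def)
  moreover have "f 1 \<in> carrier (four_chain f op)" "f 2 \<in> carrier (four_chain f op)"
    by (auto simp: four_chain_def)
  ultimately have "f 1 = f 2" by (meson inj_onD)
  then show False by simp
qed

end

theorem theorem28:
  fixes \<sigma> :: "letter list"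
  assumes "infinite (UNIV :: 'a set)"
    and "subseq \<sigma> letters"
  shows "\<not> (\<exists>H. hilbert_system H \<and>
              equivalent_algebraic_semantics
                (PM_sl \<sigma> :: ('a, const_sym, neg_sym, sl_sym) alg set) H)
       \<and> \<not> (\<exists>H. hilbert_system H \<and>
              equivalent_algebraic_semantics
                (PM_l \<sigma> :: ('a, const_sym, neg_sym, l_sym) alg set) H)"
proof -
  obtain f :: "nat \<Rightarrow> 'a" where f: "inj f"
    using infinite_countable_subset[OF assms(1)] by blast
  have "sl_op b = min \<or> sl_op b = max" for b by (cases b) auto
  moreover have "l_op b = min \<or> l_op b = max" for b by (cases b) auto
  ultimately show ?thesis
    using four_chain_not_algebraizable[OF f _ four_chain_in_PM_sl[OF f]]
      four_chain_not_algebraizable[OF f _ four_chain_in_PM_l[OF f]]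
    by blast
qed

end
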